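(* Let $\langle\mathcal H,\mathcal O,\phi\rangle$ be an information leakage channel (probabilistic or deterministic) with inputs $h_1,\dots,h_n$, and let a family of constraints on the input probabilities be given, consisting of $C_0\equiv\sum_i h_i=1$ and $C_k\equiv g_k(h)\ge F_k$ for $k=1,\dots,m$, where $g_k(h)=\sum_i h_i f_{i,k}$ with real constants $f_{i,k}$, $F_k$. Let the input probabilities $(h_i)_{1\le i\le n}$ maximize $I(h;O)$ among all input probability distributions satisfying these constraints, and let $\lambda_0\in\mathbb R$ and $\lambda_1,\dots,\lambda_m\ge 0$ be multipliers for which, with $f_{i,0}=1$, $$\sum_{o_s\in\hat O_i}\phi_{s,i}\ln\Big(\frac{\phi_{s,i}}{o_s}\Big)-1+\sum_{k=0}^m\lambda_k f_{i,k}=0\quad\text{for all } i .$$ Then the channel capacity, i.e. the maximum of $I(h;O)$ over the input distributions satisfying the constraints, equals $$\sum_i h_i\Big(1-\sum_{k=0}^m\lambda_k f_{i,k}\Big)d,\qquad d=\frac1{\ln 2}.$$ In the case $\lambda_k=0$ for all $k>0$, this simplifies to $d(1-\lambda_0)$.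
   Context: An information leakage channel is a triple $\langle\mathcal H,\mathcal O,\phi\rangle$, where $\mathcal H=\{h_1,\dots,h_n\}$ is a finite set of confidential inputs, $\mathcal O=\{o_1,o_2,\dots\}$ is a finite set of observations, and $\phi=P(O\mid h)$ is a conditional probability matrix: $\phi_{j,i}$ is the probability of observing $o_j$ given the input $h_i$ (so $\phi_{j,i}\ge 0$ and $\sum_j\phi_{j,i}=1$ for each $i$). The channel is deterministic if each input produces exactly one observation (with probability $1$). Here $h$ is a random variable with values in $\mathcal H$ and $O$ is the resulting random variable with values in $\mathcal O$. Notational convention: $h_i$ also denotes the probability of the input $h_i$, and $o_j$ also denotes the probability of the observation $o_j$, i.e. $o_j=\sum_i h_i\phi_{j,i}$. $\hat O_i$ denotes the set of observations possible for the secret $h_i$, i.e. the set of non-zero observations $o_s$ compatible with input $h_i$ ($\phi_{s,i}\ne 0$, $o_s\neq 0$). $I(h;O)=H(h)-H(h\mid O)=\sum_{i,k}h_i\phi_{k,i}\log_2\frac{\phi_{k,i}}{o_k}$ (Shannon mutual information in bits, with the usual convention that terms with $h_i\phi_{k,i}=0$ are $0$). *)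

theory Defs
  imports "HOL-Probability.Information"
begin

text \<open>The matrix is indexed as in \<open>\<phi>\<^sub>j\<^sub>,\<^sub>i\<close>: \<open>\<phi> j i\<close> is the probability of the observation \<open>j\<close>
  given the input \<open>i\<close>. Functions are only relevant on the carriers \<open>H\<close> and \<open>Obs\<close>.\<close>

definition channel :: "'h set \<Rightarrow> 'o set \<Rightarrow> ('o \<Rightarrow> 'h \<Rightarrow> real) \<Rightarrow> bool" where
  "channel H Obs \<phi> \<longleftrightarrow> finite H \<and> finite Obs \<and>
     (\<forall>i\<in>H. \<forall>j\<in>Obs. 0 \<le> \<phi> j i) \<and> (\<forall>i\<in>H. (\<Sum>j\<in>Obs. \<phi> j i) = 1)"

definition input_distribution :: "'h set \<Rightarrow> ('h \<Rightarrow> real) \<Rightarrow> bool" where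
  "input_distribution H h \<longleftrightarrow> (\<forall>i\<in>H. 0 \<le> h i) \<and> (\<Sum>i\<in>H. h i) = 1"

definition obs_prob :: "'h set \<Rightarrow> ('o \<Rightarrow> 'h \<Rightarrow> real) \<Rightarrow> ('h \<Rightarrow> real) \<Rightarrow> 'o \<Rightarrow> real" where
  "obs_prob H \<phi> h j = (\<Sum>i\<in>H. h i * \<phi> j i)"

text \<open>The set of observations possible for the input \<open>i\<close>.\<close>

definition possible_obs ::
  "'h set \<Rightarrow> 'o set \<Rightarrow> ('o \<Rightarrow> 'h \<Rightarrow> real) \<Rightarrow> ('h \<Rightarrow> real) \<Rightarrow> 'h \<Rightarrow> 'o set" where
  "possible_obs H Obs \<phi> h i = {s \<in> Obs. \<phi> s i \<noteq> 0 \<and> obs_prob H \<phi> h s \<noteq> 0}"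

text \<open>The joint law of (input, observation); the two random variables are \<open>fst\<close> and \<open>snd\<close>.\<close>

definition joint_measure ::
  "'h set \<Rightarrow> 'o set \<Rightarrow> ('o \<Rightarrow> 'h \<Rightarrow> real) \<Rightarrow> ('h \<Rightarrow> real) \<Rightarrow> ('h \<times> 'o) measure" where
  "joint_measure H Obs \<phi> h = point_measure (H \<times> Obs) (\<lambda>(i, j). ennreal (h i * \<phi> j i))"

definition mutual_info ::
  "'h set \<Rightarrow> 'o set \<Rightarrow> ('o \<Rightarrow> 'h \<Rightarrow> real) \<Rightarrow> ('h \<Rightarrow> real) \<Rightarrow> real" where
  "mutual_info H Obs \<phi> h = prob_space.mutual_information (joint_measure H Obs \<phi> h) 2
     (count_space H) (count_space Obs) fst snd"

text \<open>The constraint \<open>C\<^sub>0\<close>, i.e. \<open>\<Sum>\<^sub>i h\<^sub>i = 1\<close>, is part of \<open>input_distribution\<close>; the remaining ones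
  are \<open>\<Sum>\<^sub>i h\<^sub>i f\<^sub>i\<^sub>,\<^sub>k \<ge> F\<^sub>k\<close> for \<open>k = 1, \<dots>, m\<close>. The value \<open>F 0\<close> is not used.\<close>

definition feasible ::
  "'h set \<Rightarrow> nat \<Rightarrow> ('h \<Rightarrow> nat \<Rightarrow> real) \<Rightarrow> (nat \<Rightarrow> real) \<Rightarrow> ('h \<Rightarrow> real) \<Rightarrow> bool" where
  "feasible H m f F h \<longleftrightarrow> input_distribution H h \<and> (\<forall>k\<in>{1..m}. (\<Sum>i\<in>H. h i * f i k) \<ge> F k)"

definition capacity ::
  "'h set \<Rightarrow> 'o set \<Rightarrow> ('o \<Rightarrow> 'h \<Rightarrow> real) \<Rightarrow> nat \<Rightarrow> ('h \<Rightarrow> nat \<Rightarrow> real) \<Rightarrow> (nat \<Rightarrow> real) \<Rightarrow> real" where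
  "capacity H Obs \<phi> m f F = (SUP h\<in>{h. feasible H m f F h}. mutual_info H Obs \<phi> h)"

text \<open>The supremum is a maximum as soon as there is a maximizer.\<close>

lemma capacity_eq_maximum:
  assumes "is_arg_max (mutual_info H Obs \<phi>) (feasible H m f F) h"
  shows "capacity H Obs \<phi> m f F = mutual_info H Obs \<phi> h"
  unfolding capacity_def using assms
  by (intro cSup_eq_maximum) (auto simp: is_arg_max_def not_less)

context
  fixes H :: "'h set" and Obs :: "'o set" and \<phi> :: "'o \<Rightarrow> 'h \<Rightarrow> real" and h :: "'h \<Rightarrow> real"
  assumes ch: "channel H Obs \<phi>" and h: "input_distribution H h"
begin

private lemma finH: "finite H" and finO: "finite Obs"
  using ch by (auto simp: channel_def)

private lemma nn: "i \<in> H \<Longrightarrow> j \<in> Obs \<Longrightarrow> 0 \<le> h i * \<phi> j i"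
  using ch h by (auto simp: channel_def input_distribution_def)

private lemma ne: "H \<noteq> {}" "Obs \<noteq> {}"
  using ch h by (force simp: channel_def input_distribution_def)+

private lemma emeasure_joint:
  assumes "A \<subseteq> H \<times> Obs"
  shows "emeasure (joint_measure H Obs \<phi> h) A = ennreal (\<Sum>(i, j)\<in>A. h i * \<phi> j i)"
proof -
  have "finite (H \<times> Obs)" using finH finO by simp
  then have "emeasure (joint_measure H Obs \<phi> h) A = (\<Sum>(i, j)\<in>A. ennreal (h i * \<phi> j i))"
    unfolding joint_measure_def using assms by (rule emeasure_point_measure_finite)
  also have "\<dots> = ennreal (\<Sum>(i, j)\<in>A. h i * \<phi> j i)"
    using assms nn by (subst sum_ennreal[symmetric]) (auto intro!: sum.cong)
  finally show ?thesis .
qed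

private lemma measure_joint:
  assumes "A \<subseteq> H \<times> Obs"
  shows "measure (joint_measure H Obs \<phi> h) A = (\<Sum>(i, j)\<in>A. h i * \<phi> j i)"
  unfolding measure_def emeasure_joint[OF assms]
  by (rule enn2real_ennreal) (use assms nn in \<open>auto intro!: sum_nonneg\<close>)

private lemma space_joint: "space (joint_measure H Obs \<phi> h) = H \<times> Obs"
  by (simp add: joint_measure_def space_point_measure)

private lemma row: "i \<in> H \<Longrightarrow> (\<Sum>j\<in>Obs. h i * \<phi> j i) = h i"
  using ch by (simp add: channel_def flip: sum_distrib_left)

lemma information_space_joint: "information_space (joint_measure H Obs \<phi> h) 2"
proof -
  have "(\<Sum>(i, j)\<in>H \<times> Obs. h i * \<phi> j i) = (\<Sum>i\<in>H. \<Sum>j\<in>Obs. h i * \<phi> j i)"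
    by (rule sum.cartesian_product[symmetric])
  also have "\<dots> = 1"
    using h row by (simp add: input_distribution_def)
  finally have "prob_space (joint_measure H Obs \<phi> h)"
    by (intro prob_spaceI) (simp add: space_joint emeasure_joint)
  then show ?thesis
    by (simp add: information_space_def information_space_axioms_def)
qed

private lemma simple_joint: "simple_function (joint_measure H Obs \<phi> h) X"
  using finH finO
  by (auto simp: simple_function_def space_joint)
     (auto simp: joint_measure_def sets_point_measure)

private lemma img: "fst ` (H \<times> Obs) = H" "snd ` (H \<times> Obs) = Obs"
  using ne by auto

lemma mutual_info_eq_entropy:
  "mutual_info H Obs \<phi> h =
     prob_space.entropy (joint_measure H Obs \<phi> h) 2 (count_space H) fst -
     prob_space.conditional_entropy (joint_measure H Obs \<phi> h) 2
       (count_space H) (count_space Obs) fst snd"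
  using information_space.mutual_information_eq_entropy_conditional_entropy
    [OF information_space_joint simple_joint[of fst] simple_joint[of snd]]
  by (simp add: mutual_info_def space_joint img ne)

lemma mutual_info_eq_sum:
  "mutual_info H Obs \<phi> h =
     (\<Sum>i\<in>H. \<Sum>j\<in>Obs. h i * \<phi> j i * log 2 (\<phi> j i / obs_prob H \<phi> h j))"
proof -
  let ?M = "joint_measure H Obs \<phi> h"
  interpret information_space ?M 2 by (rule information_space_joint)
  let ?P = "\<lambda>X x. measure ?M (X -` {x} \<inter> space ?M)"
  have "mutual_information 2 (count_space (fst ` space ?M)) (count_space (snd ` space ?M)) fst snd =
    (\<Sum>(i, j)\<in>(\<lambda>x. (fst x, snd x)) ` space ?M.
      ?P (\<lambda>x. (fst x, snd x)) (i, j) *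
      log 2 (?P (\<lambda>x. (fst x, snd x)) (i, j) / (?P fst i * ?P snd j)))"
    by (rule mutual_information_simple_distributed;
        rule simple_distributedI[OF simple_joint measure_nonneg refl])
  also have "\<dots> = (\<Sum>(i, j)\<in>H \<times> Obs. h i * \<phi> j i * log 2 (\<phi> j i / obs_prob H \<phi> h j))"
  proof (rule sum.cong)
    fix x assume "x \<in> H \<times> Obs"
    then obtain i j where x: "x = (i, j)" and i: "i \<in> H" and j: "j \<in> Obs" by auto
    have "fst -` {i} \<inter> space ?M = {i} \<times> Obs" using i by (auto simp: space_joint)
    then have 1: "?P fst i = h i" using i
      by (simp add: measure_joint row Sigma_mono flip: sum.cartesian_product)
    have "snd -` {j} \<inter> space ?M = H \<times> {j}" using j by (auto simp: space_joint)
    then have 2: "?P snd j = obs_prob H \<phi> h j" using j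
      by (simp add: measure_joint obs_prob_def Sigma_mono flip: sum.cartesian_product)
    have "(\<lambda>x. (fst x, snd x)) -` {(i, j)} \<inter> space ?M = {(i, j)}"
      using i j by (auto simp: space_joint)
    then have 3: "?P (\<lambda>x. (fst x, snd x)) (i, j) = h i * \<phi> j i" using i j
      by (simp add: measure_joint)
    show "(case x of (i, j) \<Rightarrow> ?P (\<lambda>x. (fst x, snd x)) (i, j) *
        log 2 (?P (\<lambda>x. (fst x, snd x)) (i, j) / (?P fst i * ?P snd j))) =
      (case x of (i, j) \<Rightarrow> h i * \<phi> j i * log 2 (\<phi> j i / obs_prob H \<phi> h j))"
      unfolding x prod.case 1 2 3 by simp
  qed (simp add: space_joint)
  also have "\<dots> = (\<Sum>i\<in>H. \<Sum>j\<in>Obs. h i * \<phi> j i * log 2 (\<phi> j i / obs_prob H \<phi> h j))"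
    by (rule sum.cartesian_product[symmetric])
  finally show ?thesis
    by (simp add: mutual_info_def space_joint img ne)
qed

end

end

theory Submission
  imports Defs
begin

text \<open>Observations outside the possible set contribute nothing: either \<open>\<phi> s i = 0\<close>, or the
  observation has probability \<open>0\<close> and \<open>log 2 (\<phi> s i / 0) = 0\<close>.\<close>

lemma mutual_info_eq_sum_possible_obs:
  assumes "channel H Obs \<phi>" and "input_distribution H h"
  shows "mutual_info H Obs \<phi> h =
    (\<Sum>i\<in>H. h i *
      (\<Sum>s\<in>possible_obs H Obs \<phi> h i. \<phi> s i * ln (\<phi> s i / obs_prob H \<phi> h s))) / ln 2"
proof -
  have "(\<Sum>s\<in>possible_obs H Obs \<phi> h i. \<phi> s i * ln (\<phi> s i / obs_prob H \<phi> h s)) =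
      (\<Sum>s\<in>Obs. \<phi> s i * ln (\<phi> s i / obs_prob H \<phi> h s))" for i
    using assms(1)
    by (intro sum.mono_neutral_left) (auto simp: channel_def possible_obs_def)
  \<comment> \<open>Unfolding \<open>log 2 x = ln x / ln 2\<close> passes from bits to nats; the
    common factor \<open>1 / ln 2\<close> is pulled out of both sums and later becomes
    \<open>d\<close>.\<close>
  then show ?thesis
    by (simp add: mutual_info_eq_sum[OF assms] log_def sum_distrib_left sum_divide_distrib
        mult.assoc)
qed

theorem proposition3p3:
  fixes H :: "'h set" and Obs :: "'o set" and \<phi> :: "'o \<Rightarrow> 'h \<Rightarrow> real"
    and m :: nat and f :: "'h \<Rightarrow> nat \<Rightarrow> real" and F :: "nat \<Rightarrow> real"
    and h :: "'h \<Rightarrow> real" and lam :: "nat \<Rightarrow> real" and d :: real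
  assumes "channel H Obs \<phi>"
    and "\<And>i. i \<in> H \<Longrightarrow> f i 0 = 1"
    and "is_arg_max (mutual_info H Obs \<phi>) (feasible H m f F) h"
    and "\<And>k. k \<in> {1..m} \<Longrightarrow> 0 \<le> lam k"
    and "\<And>i. i \<in> H \<Longrightarrow>
           (\<Sum>s\<in>possible_obs H Obs \<phi> h i. \<phi> s i * ln (\<phi> s i / obs_prob H \<phi> h s)) - 1
             + (\<Sum>k=0..m. lam k * f i k) = 0"
    and "d = 1 / ln 2"
  shows "capacity H Obs \<phi> m f F = (\<Sum>i\<in>H. h i * (1 - (\<Sum>k=0..m. lam k * f i k)) * d) \<and>
         ((\<forall>k\<in>{1..m}. lam k = 0) \<longrightarrow> capacity H Obs \<phi> m f F = d * (1 - lam 0))"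
proof -
  let ?L = "\<lambda>i. \<Sum>k=0..m. lam k * f i k"
  have h: "input_distribution H h"
    using assms(3) by (simp add: is_arg_max_def feasible_def)
  \<comment> \<open>Maximality of \<open>h\<close> enters here: the supremum is attained at
    \<open>h\<close>, so it remains to evaluate the mutual information at this one point.\<close>
  have "capacity H Obs \<phi> m f F = mutual_info H Obs \<phi> h"
    using assms(3) by (rule capacity_eq_maximum)
  also have "\<dots> = (\<Sum>i\<in>H. h i *
      (\<Sum>s\<in>possible_obs H Obs \<phi> h i. \<phi> s i * ln (\<phi> s i / obs_prob H \<phi> h s))) / ln 2"
    using assms(1) h by (rule mutual_info_eq_sum_possible_obs)
  also have "\<dots> = (\<Sum>i\<in>H. h i * (1 - ?L i)) / ln 2"
  proof -
    \<comment> \<open>The multiplier equation, solved for its logarithmic sum, is exactly the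
      coefficient of \<open>h i\<close>. It is assumed at every input, so inputs with
      \<open>h i = 0\<close> need no separate case.\<close>
    have "(\<Sum>s\<in>possible_obs H Obs \<phi> h i. \<phi> s i * ln (\<phi> s i / obs_prob H \<phi> h s)) = 1 - ?L i"
      if "i \<in> H" for i
      using assms(5)[OF that] by linarith
    then show ?thesis by simp
  qed
  also have "\<dots> = (\<Sum>i\<in>H. h i * (1 - ?L i) * d)"
    by (simp add: assms(6) sum_divide_distrib)
  finally have capacity: "capacity H Obs \<phi> m f F = (\<Sum>i\<in>H. h i * (1 - ?L i) * d)" .
  have "capacity H Obs \<phi> m f F = d * (1 - lam 0)" if "\<forall>k\<in>{1..m}. lam k = 0"
  proof -
    \<comment> \<open>Splitting off \<open>k = 0\<close> leaves \<open>lam 0 * f i 0\<close> with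
      \<open>f i 0 = 1\<close>; all later terms vanish.\<close>
    have "?L i = lam 0" if "i \<in> H" for i
      using \<open>\<forall>k\<in>{1..m}. lam k = 0\<close> assms(2)[OF that] by (simp add: sum.atLeast_Suc_atMost)
    \<comment> \<open>The bracket no longer depends on \<open>i\<close>, so what is left to sum is
      the total input probability, which is 1.\<close>
    then have "capacity H Obs \<phi> m f F = (\<Sum>i\<in>H. h i) * ((1 - lam 0) * d)"
      by (simp add: capacity sum_distrib_right mult.assoc)
    then show ?thesis
      using h by (simp add: input_distribution_def)
  qed
  with capacity show ?thesis by blast
qed

end
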